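(* There exist a number of qubits $N$ and a number of layers $D$ for which the set of probability distributions $\mathcal{Q}^{(N,D)}_{\mathcal{E}_c}$ (generated by the mixed-unitary channel ansatz) is strictly larger than the set $\mathcal{Q}^{(N,D)}_{U_c}$ (generated by the unitary ansatz), i.e. $\mathcal{Q}^{(N,D)}_{U_c}\subsetneq\mathcal{Q}^{(N,D)}_{\mathcal{E}_c}$, in the following sense: there exist a distribution $q^*\in\mathcal{Q}^{(N,D)}_{\mathcal{E}_c}$ and a real number $\delta>0$ such that $$\inf_{q\in\mathcal{Q}^{(N,D)}_{U_c}}\ \sum_{x\in\{0,1\}^N}|q^*(x)-q(x)|\ \ge\ \delta .$$
   Context: Let $N\ge 3$ and $D\ge 1$ be integers. Consider $N$ qubits with Hilbert space $(\mathbb{C}^2)^{\otimes N}$, arranged on a ring, so that qubit indices $i\in\{1,\dots,N\}$ are read modulo $N$. Let $X_i, Z_i$ denote the Pauli operators acting on qubit $i$, and let $|x\rangle$, $x\in\{0,1\}^N$, denote the computational ($Z$-) basis. Clifford quantum cellular automaton $T_c$: the unitary obtained by first applying controlled-$Z$ gates between all pairs of neighbouring qubits $(i,i+1)$ on the ring and then a Hadamard gate on every qubit, $$T_c=\Big(\prod_{i=1}^N H_i\Big)\Big(\prod_{i=1}^N CZ_{i,i+1}\Big).$$ It satisfies $T_cX_iT_c^\dagger=X_{i-1}Z_iX_{i+1}$ and $T_cZ_iT_c^\dagger=X_i$. Parameters: angles $\boldsymbol\theta=(\theta_i^j)\in\mathbb{R}^{N\times D}$ and correction probabilities $\mathbf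 p=(p_i^j)\in[0,1]^{N\times D}$, where $i\in\{1,\dots,N\}$ indexes qubits and $j\in\{1,\dots,D\}$ indexes layers. For a byproduct pattern $\mathbf s=(s_i^j)\in\{0,1\}^{N\times D}$ define the unitary $$U_c(\boldsymbol\theta,\mathbf s)=V_DV_{D-1}\cdots V_1,\qquad V_j=T_c\prod_{i=1}^N Z_i^{s_i^j}\exp\!\big(i\,\theta_i^jZ_i\big),$$ where in the exponential the prefactor $i$ is the imaginary unit. The unitary ansatz is $U_c(\boldsymbol\theta)=U_c(\boldsymbol\theta,\mathbf 0)$. The channel ansatz is $$\mathcal{E}_c(\boldsymbol\theta,\mathbf p)[\rho]=\sum_{\mathbf s\in\{0,1\}^{N\times D}}p(\mathbf s)\,U_c(\boldsymbol\theta,\mathbf s)\,\rho\,U_c(\boldsymbol\theta,\mathbf s)^\dagger,$$ where under $p(\mathbf s)$ the bits $s_i^j$ are independent with $\Pr(s_i^j=1)=\tfrac12(1-p_i^j)$. In particular, $\mathbf p=\mathbf 1$ (all entries equal to $1$) gives $\mathcal{E}_c(\boldsymbol\theta,\mathbf 1)[\rho]=U_c(\boldsymbol\theta)\rho U_c(\boldsymbol\theta)^\dagger$. The input state is $\rho=(|+\rangle\langle+|)^{\otimes N}$ with $|+\rangle=(|0\rangle+|1\rangle)/\sqrt2$, and the output is measured in the computational basis, giving the probability distribution on $\{0,1\}^N$ $$q_{(\boldsymbol\theta,\mathbf p)}(x)=\langle x|\,\mathcal{E}_c(\boldsymbol\theta,\mathbf p)[\rho]\,|x\rangle .$$ Sets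 of generated distributions: $$\mathcal{Q}^{(N,D)}_{U_c}=\{q_{(\boldsymbol\theta,\mathbf 1)}:\boldsymbol\theta\in\mathbb{R}^{N\times D}\},\qquad \mathcal{Q}^{(N,D)}_{\mathcal{E}_c}=\{q_{(\boldsymbol\theta,\mathbf p)}:\boldsymbol\theta\in\mathbb{R}^{N\times D},\ \mathbf p\in[0,1]^{N\times D}\}.$$ The $L^{(1)}$ distance between two distributions $q,q'$ on $\{0,1\}^N$ is $\sum_{x}|q(x)-q'(x)|$. *)

theory Defs
  imports "HOL-Analysis.Analysis" "Jordan_Normal_Form.Schur_Decomposition"
begin

text \<open>Qubits and layers are numbered from \<open>0\<close>, so the ring neighbour of qubit \<open>i\<close> is \<open>(i + 1) mod N\<close>. A
  string in \<open>{0,1}\<^sup>N\<close> is encoded as a number \<open>x < 2 ^ N\<close>, the \<open>j\<close>-th symbol (the value of qubit \<open>j\<close>)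
  being \<open>bit x j\<close>. Operators on \<open>N\<close> qubits are \<open>2 ^ N \<times> 2 ^ N\<close> matrices in the computational basis.\<close>

text \<open>The sum is taken entrywise; for square \<open>A\<close> it is the usual absolutely convergent power series.\<close>

definition mat_exp :: "complex mat \<Rightarrow> complex mat" where
  "mat_exp A = mat (dim_row A) (dim_col A) (\<lambda>(i, j). \<Sum>k. (A ^\<^sub>m k) $$ (i, j) / fact k)"

text \<open>Ordered product: \<open>mat_prod n [A\<^sub>1, \<dots>, A\<^sub>m] = A\<^sub>1 * \<dots> * A\<^sub>m\<close> for \<open>n \<times> n\<close> matrices.\<close>

definition mat_prod :: "nat \<Rightarrow> complex mat list \<Rightarrow> complex mat" where
  "mat_prod n As = foldr (*) As (1\<^sub>m n)"

definition ketbra :: "complex vec \<Rightarrow> complex vec \<Rightarrow> complex mat" where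
  "ketbra v w = mat (dim_vec v) (dim_vec w) (\<lambda>(i, j). v $ i * cnj (w $ j))"

definition ket0 :: "complex vec" where "ket0 = unit_vec 2 0"

definition ket1 :: "complex vec" where "ket1 = unit_vec 2 1"

definition ket_plus :: "complex vec" where
  "ket_plus = complex_of_real (1 / sqrt 2) \<cdot>\<^sub>v (ket0 + ket1)"

definition pauli_Z :: "complex mat" where
  "pauli_Z = mat_of_rows_list 2 [[1, 0], [0, -1]]"

definition hadamard :: "complex mat" where
  "hadamard = complex_of_real (1 / sqrt 2) \<cdot>\<^sub>m mat_of_rows_list 2 [[1, 1], [1, -1]]"

text \<open>The tensor product of the \<open>2 \<times> 2\<close> matrices \<open>A 0, \<dots>, A (N - 1)\<close>, factor \<open>j\<close> acting on qubit \<open>j\<close>.\<close>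

definition tensor :: "nat \<Rightarrow> (nat \<Rightarrow> complex mat) \<Rightarrow> complex mat" where
  "tensor N A = mat (2 ^ N) (2 ^ N)
     (\<lambda>(x, y). \<Prod>j<N. A j $$ (of_bool (bit x j), of_bool (bit y j)))"

definition on_qubit :: "nat \<Rightarrow> nat \<Rightarrow> complex mat \<Rightarrow> complex mat" where
  "on_qubit N i A = tensor N ((\<lambda>_. 1\<^sub>m 2)(i := A))"

definition CZ :: "nat \<Rightarrow> nat \<Rightarrow> nat \<Rightarrow> complex mat" where
  "CZ N i k = on_qubit N i (ketbra ket0 ket0)
     + on_qubit N i (ketbra ket1 ket1) * on_qubit N k pauli_Z"

definition T_c :: "nat \<Rightarrow> complex mat" where
  "T_c N = mat_prod (2 ^ N) (map (\<lambda>i. on_qubit N i hadamard) [0..<N])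
     * mat_prod (2 ^ N) (map (\<lambda>i. CZ N i ((i + 1) mod N)) [0..<N])"

text \<open>Parameters and byproduct patterns are indexed by (qubit, layer), i.e. \<open>\<theta> i j\<close> is
  \<open>\<theta>\<^sub>i\<^sup>j\<close>. Only indices \<open>i < N\<close> and \<open>j < D\<close> are ever used.\<close>

definition layer :: "nat \<Rightarrow> (nat \<Rightarrow> nat \<Rightarrow> real) \<Rightarrow> (nat \<times> nat \<Rightarrow> nat) \<Rightarrow> nat \<Rightarrow> complex mat" where
  "layer N \<theta> s j = T_c N * mat_prod (2 ^ N)
     (map (\<lambda>i. on_qubit N i pauli_Z ^\<^sub>m s (i, j)
               * mat_exp ((\<i> * complex_of_real (\<theta> i j)) \<cdot>\<^sub>m on_qubit N i pauli_Z)) [0..<N])"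

text \<open>The reversal puts the last layer leftmost, so layer \<open>0\<close> is applied first.\<close>

definition U_c :: "nat \<Rightarrow> nat \<Rightarrow> (nat \<Rightarrow> nat \<Rightarrow> real) \<Rightarrow> (nat \<times> nat \<Rightarrow> nat) \<Rightarrow> complex mat" where
  "U_c N D \<theta> s = mat_prod (2 ^ N) (rev (map (layer N \<theta> s) [0..<D]))"

definition patterns :: "nat \<Rightarrow> nat \<Rightarrow> (nat \<times> nat \<Rightarrow> nat) set" where
  "patterns N D = ({..<N} \<times> {..<D}) \<rightarrow>\<^sub>E {0, 1}"

definition pattern_prob :: "nat \<Rightarrow> nat \<Rightarrow> (nat \<Rightarrow> nat \<Rightarrow> real) \<Rightarrow> (nat \<times> nat \<Rightarrow> nat) \<Rightarrow> real" where
  "pattern_prob N D p s = (\<Prod>(i, j)\<in>{..<N} \<times> {..<D}.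
     if s (i, j) = 1 then (1 - p i j) / 2 else 1 - (1 - p i j) / 2)"

text \<open>The sum of matrices is written entrywise, as matrices of unspecified dimension do not form an
  additive monoid.\<close>

definition channel_c :: "nat \<Rightarrow> nat \<Rightarrow> (nat \<Rightarrow> nat \<Rightarrow> real) \<Rightarrow> (nat \<Rightarrow> nat \<Rightarrow> real)
    \<Rightarrow> complex mat \<Rightarrow> complex mat" where
  "channel_c N D \<theta> p \<rho> = mat (2 ^ N) (2 ^ N) (\<lambda>(x, y). \<Sum>s\<in>patterns N D.
     complex_of_real (pattern_prob N D p s)
       * (U_c N D \<theta> s * \<rho> * mat_adjoint (U_c N D \<theta> s)) $$ (x, y))"

definition input_state :: "nat \<Rightarrow> complex mat" where
  "input_state N = tensor N (\<lambda>_. ketbra ket_plus ket_plus)"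

text \<open>The diagonal entries of a density matrix are real, so \<open>Re\<close> only changes the type. The value
  \<open>0\<close> at numbers that do not encode a string makes equality of distributions equality of functions.\<close>

definition output_dist :: "nat \<Rightarrow> nat \<Rightarrow> (nat \<Rightarrow> nat \<Rightarrow> real) \<Rightarrow> (nat \<Rightarrow> nat \<Rightarrow> real)
    \<Rightarrow> nat \<Rightarrow> real" where
  "output_dist N D \<theta> p x =
     (if x < 2 ^ N then Re (channel_c N D \<theta> p (input_state N) $$ (x, x)) else 0)"

definition Q_U :: "nat \<Rightarrow> nat \<Rightarrow> (nat \<Rightarrow> real) set" where
  "Q_U N D = {output_dist N D \<theta> (\<lambda>_ _. 1) |\<theta>. True}"

definition Q_E :: "nat \<Rightarrow> nat \<Rightarrow> (nat \<Rightarrow> real) set" where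
  "Q_E N D = {output_dist N D \<theta> p |\<theta> p. \<forall>i<N. \<forall>j<D. p i j \<in> {0..1}}"

definition L1_dist :: "nat \<Rightarrow> (nat \<Rightarrow> real) \<Rightarrow> (nat \<Rightarrow> real) \<Rightarrow> real" where
  "L1_dist N q q' = (\<Sum>x<2 ^ N. \<bar>q x - q' x\<bar>)"

end

theory Submission
  imports Defs
begin

text \<open>Take three qubits and one layer. The output is the ring graph state, rotated about the \<open>Z\<close> axes and
  measured in the \<open>X\<close> basis; up to sign its stabilizers without a factor \<open>Z\<close> are \<open>1\<close>, \<open>YYI\<close>, \<open>IYY\<close>, \<open>YIY\<close>
  and \<open>XXX\<close>. With \<open>S\<^sub>i = p\<^sub>i sin (2 \<theta>\<^sub>i)\<close> and \<open>C\<^sub>i = p\<^sub>i cos (2 \<theta>\<^sub>i)\<close>, the output distribution therefore has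
  two-bit correlations \<open>S\<^sub>i S\<^sub>j\<close> and three-bit correlation \<open>- C\<^sub>0 C\<^sub>1 C\<^sub>2\<close>. For \<open>\<theta>\<^sub>i = \<pi> / 4\<close> and
  \<open>p\<^sub>i = 1 / 2\<close> these are \<open>1 / 4\<close> and \<open>0\<close>. If all \<open>p\<^sub>i = 1\<close>, two-bit correlations close to \<open>1 / 4\<close> force
  \<open>S\<^sub>i\<^sup>2 = (S\<^sub>i S\<^sub>j) (S\<^sub>i S\<^sub>k) / (S\<^sub>j S\<^sub>k)\<close> to be close to \<open>1 / 4\<close>, which keeps every \<open>C\<^sub>i\<close>, and hence
  the three-bit correlation, away from \<open>0\<close>.\<close>

section \<open>Diagonal and tensor product operators\<close>

lemma nat_eq_iff_bits:
  fixes x y :: nat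
  assumes "x < 2 ^ N" "y < 2 ^ N"
  shows "x = y \<longleftrightarrow> (\<forall>j<N. bit x j = bit y j)"
proof -
  have "take_bit N x = x" "take_bit N y = y"
    using assms by (simp_all add: take_bit_nat_eq_self)
  then show ?thesis
    by (metis bit_take_bit_iff bit_eqI)
qed

text \<open>Distributivity: expanding the right-hand product selects \<open>False\<close> or
  \<open>True\<close> in each factor, and each selection is the bit pattern of exactly one
  \<open>y < 2 ^ N\<close>. This is what makes sums over basis states factor over the
  qubits.\<close>

lemma sum_prod_bits:
  fixes f :: "nat \<Rightarrow> bool \<Rightarrow> 'a::comm_semiring_1"
  shows "(\<Sum>y<2 ^ N. \<Prod>j<N. f j (bit (y::nat) j)) = (\<Prod>j<N. f j False + f j True)"
proof (induction N)
  case (Suc N)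
  \<comment> \<open>Split by the top bit: the upper half consists of the numbers
    \<open>2 ^ N + y\<close>, which have bit \<open>N\<close> set and share their lower bits with
    \<open>y\<close>.\<close>
  have split: "{..<2 ^ Suc N} = {..<2 ^ N} \<union> (+) (2 ^ N) ` {..<2 ^ N :: nat}"
    by (simp add: lessThan_atLeast0 ivl_disj_un mult_2)
  have disj: "{..<2 ^ N} \<inter> (+) (2 ^ N) ` {..<2 ^ N :: nat} = {}"
    by auto
  have lo: "\<not> bit y N" if "y < 2 ^ N" for y :: nat
    using that by (simp add: bit_iff_odd)
  have hi: "bit (2 ^ N + y) j \<longleftrightarrow> j = N \<or> bit y j" if "y < 2 ^ N" "j \<le> N" for y j :: nat
  proof -
    have "2 ^ N + y = or (2 ^ N) y"
      using lo[OF that(1)] by (intro disjunctive_add) (auto simp: bit_exp_iff)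
    then show ?thesis
      by (auto simp: bit_or_iff bit_exp_iff)
  qed
  have "(\<Sum>y<2 ^ Suc N. \<Prod>j<Suc N. f j (bit (y::nat) j))
    = (\<Sum>y<2 ^ N. \<Prod>j<Suc N. f j (bit (y::nat) j))
      + (\<Sum>y<2 ^ N. \<Prod>j<Suc N. f j (bit (2 ^ N + y :: nat) j))"
    unfolding split by (subst sum.union_disjoint[OF _ _ disj]) (auto simp: sum.reindex)
  also have "\<dots> = (\<Sum>y<2 ^ N. (\<Prod>j<N. f j (bit (y::nat) j)) * f N False)
      + (\<Sum>y<2 ^ N. (\<Prod>j<N. f j (bit (y::nat) j)) * f N True)"
    using lo hi by (intro arg_cong2[of _ _ _ _ "(+)"] sum.cong) auto
  also have "\<dots> = (\<Prod>j<Suc N. f j False + f j True)"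
    by (simp add: Suc.IH[symmetric] sum_distrib_right distrib_left)
  finally show ?case .
qed simp

lemma tensor_carrier [simp]: "tensor N A \<in> carrier_mat (2 ^ N) (2 ^ N)"
  by (simp add: tensor_def)

lemma on_qubit_carrier [simp]: "on_qubit N i A \<in> carrier_mat (2 ^ N) (2 ^ N)"
  by (simp add: on_qubit_def)

lemma tensor_cong:
  assumes "\<And>j. j < N \<Longrightarrow> A j = B j"
  shows "tensor N A = tensor N B"
  unfolding tensor_def using assms by (auto intro!: cong_mat prod.cong)

text \<open>Mixed-product rule: the summand over intermediate basis states has one factor per qubit,
  so \<open>sum_prod_bits\<close> turns the sum into a product of entries of 2 x 2 products.\<close>

lemma tensor_mult:
  assumes "\<And>j. j < N \<Longrightarrow> A j \<in> carrier_mat 2 2" "\<And>j. j < N \<Longrightarrow> B j \<in> carrier_mat 2 2"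
  shows "tensor N A * tensor N B = tensor N (\<lambda>j. A j * B j)"
proof (rule eq_matI)
  fix x z
  assume "x < dim_row (tensor N (\<lambda>j. A j * B j))" "z < dim_col (tensor N (\<lambda>j. A j * B j))"
  then have x: "x < 2 ^ N" and z: "z < 2 ^ N"
    by (simp_all add: tensor_def)
  let ?f = "\<lambda>j b. A j $$ (of_bool (bit x j), of_bool b) * B j $$ (of_bool b, of_bool (bit z j))"
  have "(tensor N A * tensor N B) $$ (x, z) = (\<Sum>y<2 ^ N. \<Prod>j<N. ?f j (bit (y::nat) j))"
    using x z by (simp add: tensor_def scalar_prod_def prod.distrib lessThan_atLeast0)
  also have "\<dots> = (\<Prod>j<N. ?f j False + ?f j True)"
    by (rule sum_prod_bits)
  also have "\<dots> = (\<Prod>j<N. (A j * B j) $$ (of_bool (bit x j), of_bool (bit z j)))"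
  proof (intro prod.cong refl)
    fix j assume "j \<in> {..<N}"
    then have *: "A j \<in> carrier_mat 2 2" "B j \<in> carrier_mat 2 2"
      using assms by auto
    have less: "of_bool b < (2::nat)" for b
      by simp
    have "(A j * B j) $$ (of_bool (bit x j), of_bool (bit z j))
       = (\<Sum>i = 0..<2. A j $$ (of_bool (bit x j), i) * B j $$ (i, of_bool (bit z j)))"
      using * less by (subst index_mult_mat) (auto simp: scalar_prod_def)
    then show "?f j False + ?f j True = (A j * B j) $$ (of_bool (bit x j), of_bool (bit z j))"
      by (simp add: numeral_2_eq_2)
  qed
  also have "\<dots> = tensor N (\<lambda>j. A j * B j) $$ (x, z)"
    using x z by (simp add: tensor_def)
  finally show "(tensor N A * tensor N B) $$ (x, z) = tensor N (\<lambda>j. A j * B j) $$ (x, z)" .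
qed (simp_all add: tensor_def)

lemma tensor_one: "tensor N (\<lambda>_. 1\<^sub>m 2) = 1\<^sub>m (2 ^ N)"
proof (rule eq_matI)
  fix x y assume "x < dim_row (1\<^sub>m (2 ^ N))" "y < dim_col (1\<^sub>m (2 ^ N))"
  then show "tensor N (\<lambda>_. 1\<^sub>m 2) $$ (x, y) = 1\<^sub>m (2 ^ N) $$ (x, y)"
    by (auto simp: tensor_def nat_eq_iff_bits[of x N y])
qed (simp_all add: tensor_def)

section \<open>Ordered matrix products\<close>

lemma mat_prod_carrier:
  assumes "\<And>A. A \<in> set As \<Longrightarrow> A \<in> carrier_mat n n"
  shows "mat_prod n As \<in> carrier_mat n n"
  using assms by (induction As) (auto simp: mat_prod_def intro!: mult_carrier_mat[of _ n n])

lemma mat_prod_append: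
  assumes "\<And>A. A \<in> set As \<union> set Bs \<Longrightarrow> A \<in> carrier_mat n n"
  shows "mat_prod n (As @ Bs) = mat_prod n As * mat_prod n Bs"
  using assms
proof (induction As)
  case Nil
  then show ?case
    using mat_prod_carrier[of Bs n] by (auto simp: mat_prod_def)
next
  case (Cons A As)
  have "A \<in> carrier_mat n n" "mat_prod n As \<in> carrier_mat n n" "mat_prod n Bs \<in> carrier_mat n n"
    using Cons.prems by (auto intro!: mat_prod_carrier)
  moreover have "mat_prod n (As @ Bs) = mat_prod n As * mat_prod n Bs"
    using Cons by auto
  ultimately show ?case
    by (simp add: mat_prod_def assoc_mult_mat[of _ n n _ n _ n])
qed

lemma mat_prod_singleton:
  assumes "A \<in> carrier_mat n n"
  shows "mat_prod n [A] = A"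
  using assms by (simp add: mat_prod_def)

lemma mat_prod_map_Suc:
  assumes "\<And>i. i \<le> m \<Longrightarrow> A i \<in> carrier_mat n n"
  shows "mat_prod n (map A [0..<Suc m]) = mat_prod n (map A [0..<m]) * A m"
  using assms by (simp add: mat_prod_singleton, subst mat_prod_append)
    (auto simp: mat_prod_singleton)

lemma mat_prod_on_qubit:
  assumes "\<And>i. i < N \<Longrightarrow> A i \<in> carrier_mat 2 2"
  shows "mat_prod (2 ^ N) (map (\<lambda>i. on_qubit N i (A i)) [0..<N]) = tensor N A"
proof -
  \<comment> \<open>Induction on the number of gates multiplied so far; qubits not yet reached carry
    the identity.\<close>
  have "mat_prod (2 ^ N) (map (\<lambda>i. on_qubit N i (A i)) [0..<m])
      = tensor N (\<lambda>j. if j < m then A j else 1\<^sub>m 2)" if "m \<le> N" for m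
    using that
  proof (induction m)
    case 0
    then show ?case by (simp add: mat_prod_def tensor_one)
  next
    case (Suc m)
    have "mat_prod (2 ^ N) (map (\<lambda>i. on_qubit N i (A i)) [0..<Suc m])
        = tensor N (\<lambda>j. if j < m then A j else 1\<^sub>m 2) * on_qubit N m (A m)"
      using Suc by (simp add: mat_prod_map_Suc del: upt_Suc)
    also have "\<dots> = tensor N (\<lambda>j. (if j < m then A j else 1\<^sub>m 2) * ((\<lambda>_. 1\<^sub>m 2)(m := A m)) j)"
      unfolding on_qubit_def using Suc.prems assms by (intro tensor_mult) auto
    also have "\<dots> = tensor N (\<lambda>j. if j < Suc m then A j else 1\<^sub>m 2)"
      using Suc.prems assms by (intro tensor_cong)
        (auto simp: less_Suc_eq right_mult_one_mat[of _ 2 2] left_mult_one_mat[of _ 2 2])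
    finally show ?case .
  qed
  from this[of N] show ?thesis
    by (auto intro: tensor_cong)
qed

section \<open>Operators diagonal in the computational basis\<close>

definition diagonal_op :: "nat \<Rightarrow> (nat \<Rightarrow> complex) \<Rightarrow> complex mat" where
  "diagonal_op n f = mat n n (\<lambda>(x, y). if x = y then f x else 0)"

lemma diagonal_op_carrier [simp]: "diagonal_op n f \<in> carrier_mat n n"
  by (simp add: diagonal_op_def)

lemma diagonal_op_cong:
  assumes "\<And>x. x < n \<Longrightarrow> f x = g x"
  shows "diagonal_op n f = diagonal_op n g"
  unfolding diagonal_op_def using assms by (auto intro!: cong_mat)

lemma index_mult_diagonal_op:
  assumes "A \<in> carrier_mat m n" "i < m" "j < n"
  shows "(A * diagonal_op n f) $$ (i, j) = A $$ (i, j) * f j"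
  using assms by (simp add: diagonal_op_def scalar_prod_def if_distrib cong: if_cong)

lemma diagonal_op_mult: "diagonal_op n f * diagonal_op n g = diagonal_op n (\<lambda>x. f x * g x)"
proof (rule eq_matI)
  fix i j
  assume "i < dim_row (diagonal_op n (\<lambda>x. f x * g x))" "j < dim_col (diagonal_op n (\<lambda>x. f x * g x))"
  then show "(diagonal_op n f * diagonal_op n g) $$ (i, j) = diagonal_op n (\<lambda>x. f x * g x) $$ (i, j)"
    by (subst index_mult_diagonal_op[of _ n]) (auto simp: diagonal_op_def)
qed (simp_all add: diagonal_op_def)

lemma diagonal_op_one: "1\<^sub>m n = diagonal_op n (\<lambda>_. 1)"
  by (auto simp: diagonal_op_def)

lemma diagonal_op_pow: "diagonal_op n f ^\<^sub>m k = diagonal_op n (\<lambda>x. f x ^ k)"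
proof (induction k)
  case 0
  show ?case
    by (auto simp: diagonal_op_def)
next
  case (Suc k)
  then show ?case
    by (simp add: diagonal_op_mult mult.commute)
qed

lemma smult_diagonal_op: "c \<cdot>\<^sub>m diagonal_op n f = diagonal_op n (\<lambda>x. c * f x)"
  by (auto simp: diagonal_op_def)

lemma mat_exp_diagonal_op: "mat_exp (diagonal_op n f) = diagonal_op n (\<lambda>x. exp (f x))"
proof (rule eq_matI)
  fix i j
  assume "i < dim_row (diagonal_op n (\<lambda>x. exp (f x)))" "j < dim_col (diagonal_op n (\<lambda>x. exp (f x)))"
  then have ij: "i < n" "j < n"
    by (simp_all add: diagonal_op_def)
  have "mat_exp (diagonal_op n f) $$ (i, j) = (\<Sum>k. (if i = j then f i ^ k else 0) / fact k)"
    using ij by (simp add: mat_exp_def diagonal_op_pow) (simp add: diagonal_op_def)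
  also have "\<dots> = (if i = j then exp (f i) else 0)"
    by (simp add: exp_def scaleR_conv_of_real divide_inverse mult.commute)
  finally show "mat_exp (diagonal_op n f) $$ (i, j) = diagonal_op n (\<lambda>x. exp (f x)) $$ (i, j)"
    using ij by (simp add: diagonal_op_def)
qed (simp_all add: mat_exp_def diagonal_op_def)

lemma mat_prod_diagonal_op:
  "mat_prod n (map (\<lambda>i. diagonal_op n (f i)) [0..<m]) = diagonal_op n (\<lambda>x. \<Prod>i<m. f i x)"
proof (induction m)
  case 0
  show ?case by (simp add: mat_prod_def diagonal_op_one)
next
  case (Suc m)
  then show ?case
    by (simp add: mat_prod_map_Suc diagonal_op_mult del: upt_Suc)
qed

text \<open>If \<open>x\<close> and \<open>y\<close> differ, they do so at some qubit
  \<open>j < N\<close>, where the factor is an off-diagonal entry of \<open>A\<close> or of the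
  identity, hence zero. For \<open>x = y\<close> every factor other than the one at \<open>i\<close>
  is 1.\<close>

lemma on_qubit_diagonal:
  assumes "i < N" "A \<in> carrier_mat 2 2" "A $$ (0, 1) = 0" "A $$ (1, 0) = 0"
  shows "on_qubit N i A = diagonal_op (2 ^ N) (\<lambda>x. A $$ (of_bool (bit x i), of_bool (bit x i)))"
proof (rule eq_matI)
  let ?R = "diagonal_op (2 ^ N) (\<lambda>x. A $$ (of_bool (bit x i), of_bool (bit x i)))"
  fix x y assume "x < dim_row ?R" "y < dim_col ?R"
  then have xy: "x < 2 ^ N" "y < 2 ^ N"
    by (simp_all add: diagonal_op_def)
  let ?a = "\<lambda>j. ((\<lambda>_. 1\<^sub>m 2)(i := A)) j $$ (of_bool (bit x j), of_bool (bit y j))"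
  have "(\<Prod>j<N. ?a j) = (if x = y then A $$ (of_bool (bit x i), of_bool (bit x i)) else 0)"
  proof (cases "x = y")
    case True
    then have "(\<Prod>j<N. ?a j) = (\<Prod>j<N. if j = i then A $$ (of_bool (bit x i), of_bool (bit x i)) else 1)"
      by (intro prod.cong) auto
    with True assms(1) show ?thesis
      by simp
  next
    case False
    then obtain j where "j < N" "bit x j \<noteq> bit y j"
      using nat_eq_iff_bits[OF xy] by auto
    moreover from this have "?a j = 0"
      using assms by (cases "bit x j"; cases "bit y j") auto
    ultimately have "(\<Prod>j<N. ?a j) = 0"
      using prod_zero[of "{..<N}" ?a] by blast
    with False show ?thesis
      by simp
  qed
  then show "on_qubit N i A $$ (x, y) = ?R $$ (x, y)"
    using xy by (simp add: on_qubit_def tensor_def diagonal_op_def)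
qed (simp_all add: on_qubit_def tensor_def diagonal_op_def)

abbreviation bit_sign :: "nat \<Rightarrow> nat \<Rightarrow> 'a::comm_ring_1" where
  "bit_sign x i \<equiv> (if bit x i then - 1 else 1)"

lemma on_qubit_pauli_Z: "i < N \<Longrightarrow> on_qubit N i pauli_Z = diagonal_op (2 ^ N) (\<lambda>x. bit_sign x i)"
  by (subst on_qubit_diagonal)
    (auto simp: pauli_Z_def mat_of_rows_list_def intro!: diagonal_op_cong)

lemma CZ_eq_diagonal_op:
  assumes "i < N" "k < N"
  shows "CZ N i k = diagonal_op (2 ^ N) (\<lambda>x. if bit x i \<and> bit x k then - 1 else 1)"
proof -
  have "on_qubit N i (ketbra ket0 ket0) = diagonal_op (2 ^ N) (\<lambda>x. if bit x i then 0 else 1)"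
    "on_qubit N i (ketbra ket1 ket1) = diagonal_op (2 ^ N) (\<lambda>x. if bit x i then 1 else 0)"
    using assms by (subst on_qubit_diagonal;
        force simp: ketbra_def ket0_def ket1_def intro!: diagonal_op_cong)+
  then have "CZ N i k = diagonal_op (2 ^ N) (\<lambda>x. if bit x i then 0 else 1)
      + diagonal_op (2 ^ N) (\<lambda>x. (if bit x i then 1 else 0) * bit_sign x k)"
    unfolding CZ_def using assms by (simp only: on_qubit_pauli_Z diagonal_op_mult)
  also have "\<dots> = diagonal_op (2 ^ N) (\<lambda>x. if bit x i \<and> bit x k then - 1 else 1)"
    by (rule eq_matI) (auto simp: diagonal_op_def)
  finally show ?thesis .
qed

section \<open>Output of a single layer\<close>

text \<open>All gates of a layer except the closing Hadamards are diagonal, so they merge into one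
  phase per basis state \<open>y\<close>: the controlled-Z signs around the ring, times the
  byproduct signs and rotation phases, in which \<open>bit_sign y i\<close> is the eigenvalue of Z
  on qubit \<open>i\<close>.\<close>

definition layer_phase :: "nat \<Rightarrow> (nat \<Rightarrow> nat \<Rightarrow> real) \<Rightarrow> (nat \<times> nat \<Rightarrow> nat) \<Rightarrow> nat \<Rightarrow> nat \<Rightarrow> complex"
  where "layer_phase N \<theta> s j y =
    (\<Prod>i<N. if bit y i \<and> bit y ((i + 1) mod N) then - 1 else 1)
    * (\<Prod>i<N. bit_sign y i ^ s (i, j) * cis (\<theta> i j * bit_sign y i))"

lemma layer_eq:
  "layer N \<theta> s j = tensor N (\<lambda>_. hadamard) * diagonal_op (2 ^ N) (layer_phase N \<theta> s j)"
proof -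
  have had: "hadamard \<in> carrier_mat 2 2"
    by (intro carrier_matI) (simp_all add: hadamard_def mat_of_rows_list_def)
  have "map (\<lambda>i. CZ N i ((i + 1) mod N)) [0..<N] = map (\<lambda>i. diagonal_op (2 ^ N)
      (\<lambda>x. if bit x i \<and> bit x ((i + 1) mod N) then - 1 else 1)) [0..<N]"
    by (intro map_cong refl CZ_eq_diagonal_op) auto
  then have T: "T_c N = tensor N (\<lambda>_. hadamard) * diagonal_op (2 ^ N)
      (\<lambda>x. \<Prod>i<N. if bit x i \<and> bit x ((i + 1) mod N) then - 1 else 1)"
    by (simp only: T_c_def mat_prod_on_qubit[OF had] mat_prod_diagonal_op)
  have "map (\<lambda>i. on_qubit N i pauli_Z ^\<^sub>m s (i, j)
        * mat_exp ((\<i> * complex_of_real (\<theta> i j)) \<cdot>\<^sub>m on_qubit N i pauli_Z)) [0..<N]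
     = map (\<lambda>i. diagonal_op (2 ^ N)
        (\<lambda>x. bit_sign x i ^ s (i, j) * cis (\<theta> i j * bit_sign x i))) [0..<N]"
    by (intro map_cong refl) (auto simp: on_qubit_pauli_Z diagonal_op_pow smult_diagonal_op
        mat_exp_diagonal_op diagonal_op_mult cis_conv_exp intro!: diagonal_op_cong)
  then have Z: "mat_prod (2 ^ N) (map (\<lambda>i. on_qubit N i pauli_Z ^\<^sub>m s (i, j)
        * mat_exp ((\<i> * complex_of_real (\<theta> i j)) \<cdot>\<^sub>m on_qubit N i pauli_Z)) [0..<N])
     = diagonal_op (2 ^ N) (\<lambda>x. \<Prod>i<N. bit_sign x i ^ s (i, j) * cis (\<theta> i j * bit_sign x i))"
    by (simp only: mat_prod_diagonal_op)
  show ?thesis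
    unfolding layer_def T Z
    by (subst assoc_mult_mat[of _ "2 ^ N" "2 ^ N" _ "2 ^ N" _ "2 ^ N"])
      (auto simp: diagonal_op_mult layer_phase_def intro!: arg_cong2[of _ _ _ _ "(*)"] diagonal_op_cong)
qed

lemma tensor_hadamard_index:
  assumes "x < 2 ^ N" "y < 2 ^ N"
  shows "tensor N (\<lambda>_. hadamard) $$ (x, y)
    = complex_of_real (1 / sqrt 2) ^ N * (\<Prod>j<N. if bit x j \<and> bit y j then - 1 else 1)"
proof -
  have "hadamard $$ (of_bool a, of_bool b) = complex_of_real (1 / sqrt 2) * (if a \<and> b then - 1 else 1)"
    for a b
    by (auto simp: hadamard_def mat_of_rows_list_def)
  then show ?thesis
    using assms by (simp only: tensor_def index_mat prod.distrib prod_constant case_prod_conv) simp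
qed

lemma input_state_index:
  assumes "x < 2 ^ N" "y < 2 ^ N"
  shows "input_state N $$ (x, y) = 1 / 2 ^ N"
proof -
  have "complex_of_real (sqrt 2) * complex_of_real (sqrt 2) = 2"
    by (simp flip: of_real_mult)
  then have "ketbra ket_plus ket_plus $$ (of_bool a, of_bool b) = 1 / 2" for a b
    by (auto simp: ketbra_def ket_plus_def ket0_def ket1_def)
  then show ?thesis
    using assms by (simp only: input_state_def tensor_def index_mat) (simp add: power_one_over)
qed

text \<open>A constant matrix is \<open>c\<close> times the outer product of the all-ones vector
  with itself, so only the row sum of \<open>A\<close> at \<open>x\<close> enters, through its
  squared modulus.\<close>

lemma conjugation_diagonal_entry:
  assumes "A \<in> carrier_mat n n" "\<rho> \<in> carrier_mat n n" "\<And>y z. y < n \<Longrightarrow> z < n \<Longrightarrow> \<rho> $$ (y, z) = c" "x < n"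
  shows "(A * \<rho> * mat_adjoint A) $$ (x, x) = c * of_real ((cmod (\<Sum>y<n. A $$ (x, y)))\<^sup>2)"
proof -
  have "(A * \<rho> * mat_adjoint A) $$ (x, x)
      = (\<Sum>z<n. (\<Sum>y<n. A $$ (x, y) * \<rho> $$ (y, z)) * cnj (A $$ (x, z)))"
    using assms by (simp add: scalar_prod_def mat_adjoint_def lessThan_atLeast0 mat_of_rows_def)
  also have "\<dots> = (\<Sum>z<n. (\<Sum>y<n. A $$ (x, y)) * c * cnj (A $$ (x, z)))"
    using assms(3) by (simp add: sum_distrib_right)
  also have "\<dots> = c * ((\<Sum>y<n. A $$ (x, y)) * cnj (\<Sum>y<n. A $$ (x, y)))"
    by (simp add: sum_distrib_left mult_ac)
  finally show ?thesis
    by (simp only: complex_norm_square)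
qed

text \<open>Of the factor \<open>1 / 4 ^ N\<close>, one \<open>1 / 2 ^ N\<close> is the squared
  Hadamard normalisation and the other comes from the entries of the input state.\<close>

lemma U_c_single_layer_output:
  assumes "x < 2 ^ N"
  shows "(U_c N 1 \<theta> s * input_state N * mat_adjoint (U_c N 1 \<theta> s)) $$ (x, x)
    = of_real ((cmod (\<Sum>y<2 ^ N. (\<Prod>j<N. if bit x j \<and> bit y j then - 1 else 1)
        * layer_phase N \<theta> s 0 y))\<^sup>2 / 4 ^ N)"
proof -
  have car: "layer N \<theta> s 0 \<in> carrier_mat (2 ^ N) (2 ^ N)"
    by (auto simp: layer_eq intro!: mult_carrier_mat[of _ _ "2 ^ N"])
  then have U: "U_c N 1 \<theta> s = layer N \<theta> s 0"
    by (simp add: U_c_def mat_prod_singleton)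
  let ?a = "\<lambda>y. (\<Prod>j<N. if bit x j \<and> bit y j then - 1 else 1) * layer_phase N \<theta> s 0 y"
  have "layer N \<theta> s 0 $$ (x, y) = complex_of_real (1 / sqrt 2) ^ N * ?a y" if "y < 2 ^ N" for y
    using assms that
    by (simp only: layer_eq index_mult_diagonal_op[OF tensor_carrier] tensor_hadamard_index mult.assoc)
  then have "(\<Sum>y<2 ^ N. layer N \<theta> s 0 $$ (x, y)) = complex_of_real (1 / sqrt 2) ^ N * (\<Sum>y<2 ^ N. ?a y)"
    by (simp add: sum_distrib_left)
  then have "(cmod (\<Sum>y<2 ^ N. layer N \<theta> s 0 $$ (x, y)))\<^sup>2 = ((1 / sqrt 2) ^ N)\<^sup>2 * (cmod (\<Sum>y<2 ^ N. ?a y))\<^sup>2"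
    by (simp add: norm_mult norm_power norm_divide power_mult_distrib)
  also have "((1 / sqrt 2) ^ N)\<^sup>2 = 1 / 2 ^ N"
    by (simp add: power_divide flip: power_mult) (simp add: power_mult mult.commute[of N])
  finally have norm: "(cmod (\<Sum>y<2 ^ N. layer N \<theta> s 0 $$ (x, y)))\<^sup>2
      = 1 / 2 ^ N * (cmod (\<Sum>y<2 ^ N. ?a y))\<^sup>2" .
  have "input_state N \<in> carrier_mat (2 ^ N) (2 ^ N)"
    by (simp add: input_state_def)
  from conjugation_diagonal_entry[OF car this input_state_index assms]
  have "(U_c N 1 \<theta> s * input_state N * mat_adjoint (U_c N 1 \<theta> s)) $$ (x, x)
      = 1 / 2 ^ N * of_real (1 / 2 ^ N * (cmod (\<Sum>y<2 ^ N. ?a y))\<^sup>2)"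
    unfolding U norm .
  also have "\<dots> = of_real ((cmod (\<Sum>y<2 ^ N. ?a y))\<^sup>2 / 4 ^ N)"
    by (simp flip: power_mult_distrib)
  finally show ?thesis .
qed

section \<open>Averaging over byproduct patterns\<close>

text \<open>A single sign \<open>(- 1) ^ s k\<close> has mean
  \<open>(1 + p) / 2 - (1 - p) / 2 = p\<close>, and by independence the means multiply. Averaging
  thus replaces each byproduct sign by its correction probability.\<close>

lemma sum_pattern_prob_parity:
  assumes "S \<subseteq> {..<N} \<times> {..<D}"
  shows "(\<Sum>s\<in>patterns N D. pattern_prob N D p s * (\<Prod>k\<in>S. (- 1) ^ s k)) = (\<Prod>(i, j)\<in>S. p i j)"
proof -
  let ?I = "{..<N} \<times> {..<D}"
  \<comment> \<open>The weight of bit \<open>b\<close> at site \<open>k\<close>, signed only for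
    \<open>k\<close> in \<open>S\<close>. The summand becomes a product over all sites, so the sum
    over patterns factors.\<close>
  define g where "g k b = (if b = 1 then (1 - p (fst k) (snd k)) / 2
      else 1 - (1 - p (fst k) (snd k)) / 2) * (if k \<in> S then (- 1) ^ b else 1)" for k and b :: nat
  have restrict: "(\<Prod>k\<in>S. h k) = (\<Prod>k\<in>?I. if k \<in> S then h k else 1)" for h :: "nat \<times> nat \<Rightarrow> real"
    using assms by (simp add: prod.inter_restrict[symmetric] Int_absorb1)
  have "(\<Sum>s\<in>patterns N D. pattern_prob N D p s * (\<Prod>k\<in>S. (- 1) ^ s k))
      = (\<Sum>s\<in>patterns N D. \<Prod>k\<in>?I. g k (s k))"
    unfolding restrict pattern_prob_def g_def case_prod_beta prod.distrib prod.collapse ..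
  also have "\<dots> = (\<Prod>k\<in>?I. \<Sum>b\<in>{0, 1}. g k b)"
    unfolding patterns_def by (subst prod_sum_PiE) auto
  also have "\<dots> = (\<Prod>k\<in>?I. if k \<in> S then p (fst k) (snd k) else 1)"
    by (intro prod.cong) (auto simp: g_def field_simps)
  finally show ?thesis
    unfolding case_prod_beta restrict .
qed

section \<open>Three qubits and one layer\<close>

lemma prod_lessThan_3: "(\<Prod>i<3. f i) = f 0 * f 1 * f (2::nat)"
  by (simp add: numeral_3_eq_3 numeral_2_eq_2)

text \<open>The sign depends only on the Hamming weight \<open>w\<close> of \<open>y\<close>, where it is
  \<open>\<surd>2 cos (\<pi> w / 2 - \<pi> / 4)\<close>.\<close>

lemma CZ_phase_triangle:
  "(\<Prod>i<3. if bit y i \<and> bit y ((i + 1) mod 3) then - 1 else 1)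
    = (1 - \<i>) / 2 * (\<Prod>i<3. if bit y i then \<i> else 1)
      + (1 + \<i>) / 2 * (\<Prod>i<3. if bit y i then - \<i> else 1)"
  by (cases "bit y 0"; cases "bit y 1"; cases "bit y 2")
    (simp_all add: prod_lessThan_3 numeral_2_eq_2 complex_eq_iff)

lemma cmod_add_power2: "(cmod (u + v))\<^sup>2 = (cmod u)\<^sup>2 + (cmod v)\<^sup>2 + 2 * Re (u * cnj v)"
  unfolding cmod_power2 by (simp add: power2_eq_square algebra_simps)

text \<open>By \<open>CZ_phase_triangle\<close> the amplitude is a sum of two terms, each a product
  over qubits. Their squared moduli are \<open>4 * (\<Prod>j<3. 1 + e j * sin (2 * t j))\<close> and
  the same with minus signs; the odd-degree terms cancel in the sum, leaving the pair correlations.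
  The interference term gives the cosine product.\<close>

lemma cmod_triangle_amplitude:
  fixes e t :: "nat \<Rightarrow> real"
  assumes e: "\<And>i. (e i)\<^sup>2 = 1"
  shows "(cmod (\<Sum>y<2 ^ 3. (\<Prod>i<3. if bit y i \<and> bit y ((i + 1) mod 3) then - 1 else 1)
        * (\<Prod>i<3. if bit (y::nat) i then e i * cis (- t i) else cis (t i))))\<^sup>2
    = 8 * (1 + e 0 * e 1 * (sin (2 * t 0) * sin (2 * t 1)) + e 1 * e 2 * (sin (2 * t 1) * sin (2 * t 2))
        + e 0 * e 2 * (sin (2 * t 0) * sin (2 * t 2))
        - e 0 * e 1 * e 2 * (cos (2 * t 0) * cos (2 * t 1) * cos (2 * t 2)))"
    (is "(cmod (\<Sum>y<2 ^ 3. ?c y * ?a y))\<^sup>2 = _")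
proof -
  define f where "f w j b = (if b then w * (e j * cis (- t j)) else cis (t j))" for w j b
  define P where "P w j = f w j False + f w j True" for w j
  have "?c y * ?a y = (1 - \<i>) / 2 * (\<Prod>j<3. f \<i> j (bit y j))
      + (1 + \<i>) / 2 * (\<Prod>j<3. f (- \<i>) j (bit y j))" for y :: nat
    unfolding CZ_phase_triangle ring_distribs mult.assoc prod.distrib[symmetric] f_def
    by (intro arg_cong2[of _ _ _ _ "(+)"] arg_cong2[of _ _ _ _ "(*)"] prod.cong) auto
  then have "(\<Sum>y<2 ^ 3. ?c y * ?a y)
      = (1 - \<i>) / 2 * (\<Sum>y<2 ^ 3. \<Prod>j<3. f \<i> j (bit (y::nat) j))
        + (1 + \<i>) / 2 * (\<Sum>y<2 ^ 3. \<Prod>j<3. f (- \<i>) j (bit (y::nat) j))"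
    by (simp only: sum.distrib sum_distrib_left)
  then have amp: "(\<Sum>y<2 ^ 3. ?c y * ?a y)
      = (1 - \<i>) / 2 * (\<Prod>j<3. P \<i> j) + (1 + \<i>) / 2 * (\<Prod>j<3. P (- \<i>) j)"
    by (simp only: sum_prod_bits P_def)
  have P: "P \<i> j = Complex (cos (t j) + e j * sin (t j)) (sin (t j) + e j * cos (t j))"
    "P (- \<i>) j = Complex (cos (t j) - e j * sin (t j)) (sin (t j) - e j * cos (t j))" for j
    by (simp_all add: P_def f_def complex_eq_iff)
  \<comment> \<open>Used with \<open>r = e j\<close> and \<open>r = - e j\<close>; as
    \<open>r\<^sup>2 = 1\<close>, the right-hand side becomes a double-angle expression.\<close>
  have "(c + r * s)\<^sup>2 + (s + r * c)\<^sup>2 = (1 + r\<^sup>2) * (s\<^sup>2 + c\<^sup>2) + 4 * (r * (s * c))"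
    for c s r :: real
    by (simp add: power2_eq_square algebra_simps)
  from this[of "cos (t j)" "e j" "sin (t j)" for j] this[of "cos (t j)" "- e j" "sin (t j)" for j]
  have plus: "(cmod (P \<i> j))\<^sup>2 = 2 * (1 + e j * sin (2 * t j))"
    and minus: "(cmod (P (- \<i>) j))\<^sup>2 = 2 * (1 - e j * sin (2 * t j))" for j
    by (simp_all add: cmod_power2 P sin_double e)
  have "Complex (c + r * s) (s + r * c) * cnj (Complex (c - r * s) (s - r * c))
      = Complex ((1 - r\<^sup>2) * (s\<^sup>2 + c\<^sup>2)) (2 * (r * (c\<^sup>2 - s\<^sup>2)))" for c s r
    by (simp add: complex_eq_iff power2_eq_square algebra_simps)
  from this[of "cos (t j)" "e j" "sin (t j)" for j]
  have cross: "P \<i> j * cnj (P (- \<i>) j) = \<i> * of_real (2 * (e j * cos (2 * t j)))" for j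
    by (simp add: P e cos_double complex_eq_iff)
  have norms: "(cmod ((1 - \<i>) / 2))\<^sup>2 = 1 / 2" "(cmod ((1 + \<i>) / 2))\<^sup>2 = 1 / 2"
    by (simp_all add: cmod_power2 power_divide)
  have "(1 - \<i>) / 2 * (\<Prod>j<3. P \<i> j) * cnj ((1 + \<i>) / 2 * (\<Prod>j<3. P (- \<i>) j))
      = (1 - \<i>) / 2 * cnj ((1 + \<i>) / 2) * (\<Prod>j<3. P \<i> j * cnj (P (- \<i>) j))"
    by (simp add: prod.distrib mult_ac)
  \<comment> \<open>The prefactor is \<open>- \<i> / 2\<close>, and the three cross factors
    contribute \<open>\<i> ^ 3 * 8\<close>, giving the real constant -4.\<close>
  also have "\<dots> = of_real (- 4 * (e 0 * e 1 * e 2 * (cos (2 * t 0) * cos (2 * t 1) * cos (2 * t 2))))"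
    unfolding cross prod_lessThan_3 by (simp add: complex_eq_iff algebra_simps)
  finally have re: "Re ((1 - \<i>) / 2 * (\<Prod>j<3. P \<i> j) * cnj ((1 + \<i>) / 2 * (\<Prod>j<3. P (- \<i>) j)))
      = - 4 * (e 0 * e 1 * e 2 * (cos (2 * t 0) * cos (2 * t 1) * cos (2 * t 2)))"
    by (simp only: Re_complex_of_real)
  show ?thesis
    unfolding amp cmod_add_power2 re
    unfolding norm_mult power_mult_distrib norms prod_lessThan_3 plus minus
    by (simp add: algebra_simps)
qed

lemma three_qubit_pattern_output:
  assumes "x < 8"
  defines "e \<equiv> \<lambda>s i. bit_sign x i * (- 1) ^ s (i, 0::nat)"
  shows "(U_c 3 1 \<theta> s * input_state 3 * mat_adjoint (U_c 3 1 \<theta> s)) $$ (x, x)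
    = complex_of_real ((1 + e s 0 * e s 1 * (sin (2 * \<theta> 0 0) * sin (2 * \<theta> 1 0))
        + e s 1 * e s 2 * (sin (2 * \<theta> 1 0) * sin (2 * \<theta> 2 0))
        + e s 0 * e s 2 * (sin (2 * \<theta> 0 0) * sin (2 * \<theta> 2 0))
        - e s 0 * e s 1 * e s 2 * (cos (2 * \<theta> 0 0) * cos (2 * \<theta> 1 0) * cos (2 * \<theta> 2 0))) / 8)"
proof -
  have sq: "(e s i)\<^sup>2 = 1" for i
    by (simp add: e_def power_mult_distrib flip: power_mult)
  \<comment> \<open>The Hadamard sign of \<open>x\<close> and the byproduct sign both appear only
    where \<open>y\<close> has a set bit, so they combine into \<open>e s i\<close>: a byproduct
    acts as a flip of the output bit.\<close>
  have phases: "(\<Prod>j<3. if bit x j \<and> bit y j then - 1 else 1)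
      * (\<Prod>i<3. bit_sign y i ^ s (i, 0) * cis (\<theta> i 0 * bit_sign y i))
    = (\<Prod>i<3. if bit y i then e s i * cis (- \<theta> i 0) else cis (\<theta> i 0))" for y
    unfolding prod.distrib[symmetric] by (intro prod.cong) (auto simp: e_def)
  have "(\<Prod>j<3. if bit x j \<and> bit y j then - 1 else 1) * layer_phase 3 \<theta> s 0 y
      = (\<Prod>i<3. if bit y i \<and> bit y ((i + 1) mod 3) then - 1 else 1)
        * (\<Prod>i<3. if bit y i then e s i * cis (- \<theta> i 0) else cis (\<theta> i 0))" for y
    unfolding layer_phase_def phases[symmetric] by (rule mult.left_commute)
  moreover have "x < 2 ^ 3"
    using assms by simp
  ultimately show ?thesis
    using cmod_triangle_amplitude[of "e s" "\<lambda>i. \<theta> i 0", OF sq]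
    by (simp only: U_c_single_layer_output) simp
qed

text \<open>A parity expansion on three bits. \<open>S\<close> and \<open>C\<close> are separate
  arguments because the channel gives
  \<open>(S i)\<^sup>2 + (C i)\<^sup>2 = (p i 0)\<^sup>2\<close>, whereas the unitary ansatz gives
  1.\<close>

definition triangle_dist :: "(nat \<Rightarrow> real) \<Rightarrow> (nat \<Rightarrow> real) \<Rightarrow> nat \<Rightarrow> real" where
  "triangle_dist S C x = (1 + bit_sign x 0 * bit_sign x 1 * (S 0 * S 1)
     + bit_sign x 1 * bit_sign x 2 * (S 1 * S 2) + bit_sign x 0 * bit_sign x 2 * (S 0 * S 2)
     - bit_sign x 0 * bit_sign x 1 * bit_sign x 2 * (C 0 * C 1 * C 2)) / 8"

text \<open>Each qubit occurring in a correlation term contributes one byproduct sign and one sine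
  or cosine; averaging turns the sign into \<open>p i 0\<close>, which is absorbed into that sine or
  cosine.\<close>

lemma output_dist_three_qubits:
  assumes x: "x < 8"
  shows "output_dist 3 1 \<theta> p x
    = triangle_dist (\<lambda>i. p i 0 * sin (2 * \<theta> i 0)) (\<lambda>i. p i 0 * cos (2 * \<theta> i 0)) x"
proof -
  define w where "w = pattern_prob 3 1 p"
  define h :: "(nat \<times> nat \<Rightarrow> nat) \<Rightarrow> nat \<Rightarrow> real" where "h s i = (- 1) ^ s (i, 0)" for s i
  define S where "S i = sin (2 * \<theta> i 0)" for i
  define C where "C i = cos (2 * \<theta> i 0)" for i
  define b :: "nat \<Rightarrow> real" where "b i = bit_sign x i" for i
  have par: "(\<Sum>s\<in>patterns 3 1. w s * (\<Prod>k\<in>T. (- 1) ^ s k)) = (\<Prod>(i, j)\<in>T. p i j)"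
    if "T \<subseteq> {..<3} \<times> {..<1}" for T
    unfolding w_def using that by (rule sum_pattern_prob_parity)
  have avg: "(\<Sum>s\<in>patterns 3 1. w s) = 1"
    "(\<Sum>s\<in>patterns 3 1. w s * (h s 0 * h s 1)) = p 0 0 * p 1 0"
    "(\<Sum>s\<in>patterns 3 1. w s * (h s 1 * h s 2)) = p 1 0 * p 2 0"
    "(\<Sum>s\<in>patterns 3 1. w s * (h s 0 * h s 2)) = p 0 0 * p 2 0"
    "(\<Sum>s\<in>patterns 3 1. w s * (h s 0 * h s 1 * h s 2)) = p 0 0 * p 1 0 * p 2 0"
    \<comment> \<open>The empty set of sites yields normalisation; the other sets yield the parities
      of the correlation terms.\<close>
    using par[of "{}"] par[of "{(0, 0), (1, 0)}"] par[of "{(1, 0), (2, 0)}"] par[of "{(0, 0), (2, 0)}"]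
      par[of "{(0, 0), (1, 0), (2, 0)}"]
    by (simp_all add: h_def mult.assoc)
  have "output_dist 3 1 \<theta> p x = Re (\<Sum>s\<in>patterns 3 1. complex_of_real (w s)
      * (U_c 3 1 \<theta> s * input_state 3 * mat_adjoint (U_c 3 1 \<theta> s)) $$ (x, x))"
    using x by (simp add: output_dist_def channel_c_def w_def)
  also have "\<dots> = (\<Sum>s\<in>patterns 3 1. w s * ((1 + (b 0 * h s 0) * (b 1 * h s 1) * (S 0 * S 1)
        + (b 1 * h s 1) * (b 2 * h s 2) * (S 1 * S 2)
        + (b 0 * h s 0) * (b 2 * h s 2) * (S 0 * S 2)
        - (b 0 * h s 0) * (b 1 * h s 1) * (b 2 * h s 2) * (C 0 * C 1 * C 2)) / 8))"
    by (simp only: three_qubit_pattern_output[OF x] of_real_mult[symmetric] of_real_sum[symmetric]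
        Re_complex_of_real b_def h_def S_def C_def)
  also have "\<dots> = (\<Sum>s\<in>patterns 3 1. w s / 8
      + w s * (h s 0 * h s 1) * (b 0 * b 1 * (S 0 * S 1) / 8)
      + w s * (h s 1 * h s 2) * (b 1 * b 2 * (S 1 * S 2) / 8)
      + w s * (h s 0 * h s 2) * (b 0 * b 2 * (S 0 * S 2) / 8)
      - w s * (h s 0 * h s 1 * h s 2) * (b 0 * b 1 * b 2 * (C 0 * C 1 * C 2) / 8))"
    by (intro sum.cong refl) (simp add: field_simps)
  also have "\<dots> = 1 / 8 + p 0 0 * p 1 0 * (b 0 * b 1 * (S 0 * S 1) / 8)
      + p 1 0 * p 2 0 * (b 1 * b 2 * (S 1 * S 2) / 8)
      + p 0 0 * p 2 0 * (b 0 * b 2 * (S 0 * S 2) / 8)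
      - p 0 0 * p 1 0 * p 2 0 * (b 0 * b 1 * b 2 * (C 0 * C 1 * C 2) / 8)"
    by (simp only: sum.distrib sum_subtractf sum_divide_distrib[symmetric] sum_distrib_right[symmetric] avg)
  also have "\<dots> = triangle_dist (\<lambda>i. p i 0 * S i) (\<lambda>i. p i 0 * C i) x"
    unfolding triangle_dist_def b_def[symmetric] by (simp add: field_simps)
  finally show ?thesis
    by (simp only: S_def C_def)
qed

section \<open>Separation of the channel output from the unitary outputs\<close>

lemma abs_sum_diff_le_L1_dist:
  assumes "\<And>x. \<bar>w x\<bar> \<le> 1"
  shows "\<bar>(\<Sum>x<2 ^ N. w x * q x) - (\<Sum>x<2 ^ N. w x * q' x)\<bar> \<le> L1_dist N q q'"
proof -
  have "\<bar>(\<Sum>x<2 ^ N. w x * q x) - (\<Sum>x<2 ^ N. w x * q' x)\<bar> = \<bar>\<Sum>x<2 ^ N. w x * (q x - q' x)\<bar>"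
    by (simp add: sum_subtractf algebra_simps)
  also have "\<dots> \<le> (\<Sum>x<2 ^ N. \<bar>w x\<bar> * \<bar>q x - q' x\<bar>)"
    by (rule order_trans[OF sum_abs]) (simp add: abs_mult)
  also have "\<dots> \<le> L1_dist N q q'"
    unfolding L1_dist_def using assms by (intro sum_mono mult_left_le_one_le) auto
  finally show ?thesis .
qed

text \<open>Distinct parity functions are orthogonal on the eight strings and each squares to 1, so
  summing against one of them extracts its coefficient.\<close>

lemma triangle_dist_parities:
  "(\<Sum>x<2 ^ 3. (bit_sign x 0 * bit_sign x 1) * triangle_dist S C x) = S 0 * S 1"
  "(\<Sum>x<2 ^ 3. (bit_sign x 1 * bit_sign x 2) * triangle_dist S C x) = S 1 * S 2"
  "(\<Sum>x<2 ^ 3. (bit_sign x 0 * bit_sign x 2) * triangle_dist S C x) = S 0 * S 2"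
  "(\<Sum>x<2 ^ 3. (bit_sign x 0 * bit_sign x 1 * bit_sign x 2) * triangle_dist S C x) = - (C 0 * C 1 * C 2)"
proof -
  have set: "{..<2 ^ 3} = {0, 1, 2, 3, 4, 5, 6, 7 :: nat}"
    by auto
  \<comment> \<open>With the monomials treated as atoms, each claim is linear in four
    unknowns.\<close>
  define a b c d where "a = S 0 * S 1" and "b = S 1 * S 2" and "c = S 0 * S 2" and "d = C 0 * C 1 * C 2"
  note defs = a_def[symmetric] b_def[symmetric] c_def[symmetric] d_def[symmetric]
  show
    "(\<Sum>x<2 ^ 3. (bit_sign x 0 * bit_sign x 1) * triangle_dist S C x) = S 0 * S 1"
    "(\<Sum>x<2 ^ 3. (bit_sign x 1 * bit_sign x 2) * triangle_dist S C x) = S 1 * S 2"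
    "(\<Sum>x<2 ^ 3. (bit_sign x 0 * bit_sign x 2) * triangle_dist S C x) = S 0 * S 2"
    "(\<Sum>x<2 ^ 3. (bit_sign x 0 * bit_sign x 1 * bit_sign x 2) * triangle_dist S C x) = - (C 0 * C 1 * C 2)"
    unfolding set triangle_dist_def defs by (simp_all add: bit_0 field_simps)
qed

text \<open>All three products lie between 3/16 and 5/16, and
  \<open>a\<^sup>2 * (b * c) = (a * b) * (a * c)\<close>; the bound is
  \<open>(5 / 16)\<^sup>2 / (3 / 16)\<close>.\<close>

lemma power2_bound_from_products:
  fixes a b c :: real
  assumes "\<bar>a * b - 1 / 4\<bar> < 1 / 16" "\<bar>a * c - 1 / 4\<bar> < 1 / 16" "\<bar>b * c - 1 / 4\<bar> < 1 / 16"
  shows "a\<^sup>2 \<le> 25 / 48"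
proof -
  have "3 / 16 \<le> b * c"
    using assms by linarith
  then have "a\<^sup>2 * (3 / 16) \<le> a\<^sup>2 * (b * c)"
    by (intro mult_left_mono) auto
  also have "\<dots> = (a * b) * (a * c)"
    by (simp add: power2_eq_square)
  also have "\<dots> \<le> (5 / 16) * (5 / 16)"
    using assms by (intro mult_mono) linarith+
  finally show ?thesis
    by simp
qed

lemma triangle_dist_separation:
  assumes unit: "\<And>i. (S i)\<^sup>2 + (C i)\<^sup>2 = 1"
  shows "1 / 16 \<le> L1_dist 3 (triangle_dist (\<lambda>_. 1 / 2) (\<lambda>_. 0)) (triangle_dist S C)"
proof (rule ccontr)
  assume "\<not> ?thesis"
  \<comment> \<open>A test function bounded by 1 changes its expectation by at most the L1 distance;
    it is applied to the four parities.\<close>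
  then have less: "\<bar>(\<Sum>x<2 ^ 3. w x * triangle_dist (\<lambda>_. 1 / 2) (\<lambda>_. 0) x)
      - (\<Sum>x<2 ^ 3. w x * triangle_dist S C x)\<bar> < 1 / 16" if "\<And>x. \<bar>w x\<bar> \<le> 1" for w
    using abs_sum_diff_le_L1_dist[where w = w and N = 3] that by (meson le_less_trans not_le)
  have "\<bar>1 / 2 * (1 / 2) - S 0 * S 1\<bar> < 1 / 16" "\<bar>1 / 2 * (1 / 2) - S 1 * S 2\<bar> < 1 / 16"
    "\<bar>1 / 2 * (1 / 2) - S 0 * S 2\<bar> < 1 / 16" "\<bar>- (0 * 0 * 0) - - (C 0 * C 1 * C 2)\<bar> < 1 / 16"
    using less[of "\<lambda>x. bit_sign x 0 * bit_sign x 1"] less[of "\<lambda>x. bit_sign x 1 * bit_sign x 2"]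
      less[of "\<lambda>x. bit_sign x 0 * bit_sign x 2"]
      less[of "\<lambda>x. bit_sign x 0 * bit_sign x 1 * bit_sign x 2"]
    unfolding triangle_dist_parities by auto
  then have pairs: "\<bar>S 0 * S 1 - 1 / 4\<bar> < 1 / 16" "\<bar>S 1 * S 2 - 1 / 4\<bar> < 1 / 16"
      "\<bar>S 0 * S 2 - 1 / 4\<bar> < 1 / 16"
    and triple: "\<bar>C 0 * C 1 * C 2\<bar> < 1 / 16"
    by (simp_all add: abs_minus_commute)
  have "(S 0)\<^sup>2 \<le> 25 / 48" "(S 1)\<^sup>2 \<le> 25 / 48" "(S 2)\<^sup>2 \<le> 25 / 48"
    using power2_bound_from_products[of "S 0" "S 1" "S 2"]
      power2_bound_from_products[of "S 1" "S 0" "S 2"]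
      power2_bound_from_products[of "S 2" "S 0" "S 1"] pairs
    by (simp_all add: mult.commute)
  then have "23 / 48 \<le> (C 0)\<^sup>2" "23 / 48 \<le> (C 1)\<^sup>2" "23 / 48 \<le> (C 2)\<^sup>2"
    using unit[of 0] unit[of 1] unit[of 2] by linarith+
  \<comment> \<open>Here \<open>23 / 48 = 1 - 25 / 48\<close>. Its cube exceeds 1/10, against the
    upper bound 1/256 from the triple correlation.\<close>
  then have "23 / 48 * (23 / 48) * (23 / 48) \<le> (C 0)\<^sup>2 * (C 1)\<^sup>2 * (C 2)\<^sup>2"
    by (intro mult_mono) auto
  moreover have "\<bar>C 0 * C 1 * C 2\<bar>\<^sup>2 \<le> (1 / 16)\<^sup>2"
    using triple by (intro power_mono) auto
  then have "(C 0)\<^sup>2 * (C 1)\<^sup>2 * (C 2)\<^sup>2 \<le> 1 / 256"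
    by (simp add: power_mult_distrib power2_eq_square[of "1 / 16"] power_divide)
  ultimately show False
    by simp
qed

theorem theorem1:
  shows "\<exists>(N::nat) (D::nat). N \<ge> 3 \<and> D \<ge> 1 \<and> Q_U N D \<subset> Q_E N D \<and>
    (\<exists>q_star \<in> Q_E N D. \<exists>\<delta>::real. \<delta> > 0 \<and>
      (INF q \<in> Q_U N D. L1_dist N q_star q) \<ge> \<delta>)"
proof -
  \<comment> \<open>At angle \<open>pi / 4\<close> the doubled angle has sine 1 and cosine 0, so
    \<open>p = 1 / 2\<close> gives \<open>S = 1 / 2\<close> and \<open>C = 0\<close>.\<close>
  define q where "q = output_dist 3 1 (\<lambda>_ _. pi / 4) (\<lambda>_ _. 1 / 2)"
  have qE: "q \<in> Q_E 3 1"
    unfolding q_def Q_E_def by fastforce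
  have sub: "Q_U 3 1 \<subseteq> Q_E 3 1"
    unfolding Q_U_def Q_E_def by fastforce
  have q: "q x = triangle_dist (\<lambda>_. 1 / 2) (\<lambda>_. 0) x" if "x < 8" for x
    unfolding q_def output_dist_three_qubits[OF that] by simp
  have far: "1 / 16 \<le> L1_dist 3 q u" if u: "u \<in> Q_U 3 1" for u
  proof -
    obtain \<theta> where \<theta>: "u = output_dist 3 1 \<theta> (\<lambda>_ _. 1)"
      using u by (auto simp: Q_U_def)
    have "u x = triangle_dist (\<lambda>i. sin (2 * \<theta> i 0)) (\<lambda>i. cos (2 * \<theta> i 0)) x" if "x < 8" for x
      unfolding \<theta> output_dist_three_qubits[OF that] by simp
    with q have "L1_dist 3 q u = L1_dist 3 (triangle_dist (\<lambda>_. 1 / 2) (\<lambda>_. 0))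
        (triangle_dist (\<lambda>i. sin (2 * \<theta> i 0)) (\<lambda>i. cos (2 * \<theta> i 0)))"
      by (simp add: L1_dist_def)
    then show ?thesis
      using triangle_dist_separation[of "\<lambda>i. sin (2 * \<theta> i 0)" "\<lambda>i. cos (2 * \<theta> i 0)"] by simp
  qed
  \<comment> \<open>Membership would put \<open>q\<close> at distance at least 1/16 from
    itself.\<close>
  then have "q \<notin> Q_U 3 1"
    by (force simp: L1_dist_def)
  with qE sub have "Q_U 3 1 \<subset> Q_E 3 1"
    by blast
  \<comment> \<open>The infimum over the reals is bounded below by \<open>far\<close> because
    \<open>Q_U 3 1\<close> is nonempty.\<close>
  moreover have "1 / 16 \<le> (INF u \<in> Q_U 3 1. L1_dist 3 q u)"
    using far by (intro cINF_greatest) (auto simp: Q_U_def)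
  ultimately show ?thesis
    using qE by (intro exI[of _ 3] exI[of _ 1] conjI bexI[of _ q] exI[of _ "1 / 16"]) simp_all
qed

end
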